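(* Let $n\in\mathbb{N}$ be divisible by $q-1$ with $h=\mathrm{ht}(n)\ge2$, and let $\mathbf{Sh}(n)=(X_1,\dots,X_h)$ be its Sheats composition. Then for $1\le i<h$ the inequality $X_{i+1}\ge qX_i$ holds.
   Context: $q=p^f$ is a power of the prime $p$; $\mathbb{N}=\{1,2,\dots\}$. For non-negative integers $a,b$ with base-$p$ digits $a_j,b_j$, $a<_pb$ means $a_j\le b_j$ for all $j$; $a\prec b$ means $a<_pb$ and $a\equiv b\pmod{q-1}$. The height $\mathrm{ht}(n)$ is the maximal $h$ for which there are pairwise distinct $0=n_0\prec n_1\prec\cdots\prec n_h<_pn$. For $n$ divisible by $q-1$ and $1\le i\le\mathrm{ht}(n)$, an $i$-composition of $n$ is a tuple $(X_1,\dots,X_i)$ of positive multiples of $q-1$ with $X_1+\dots+X_i=n$ such that there is no carry in base $p$ in this sum. The Sheats composition $\mathbf{Sh}(n)$ is the $h$-composition, $h=\mathrm{ht}(n)$, for which $(X_h,X_{h-1},\dots,X_1)$ is lexicographically maximal among all $h$-compositions of $n$. *)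

theory Defs
  imports "HOL-Number_Theory.Number_Theory"
begin

definition digit :: "nat \<Rightarrow> nat \<Rightarrow> nat \<Rightarrow> nat" where
  "digit p a j = (a div p ^ j) mod p"

text \<open>The relation written \<open>a <\<^sub>p b\<close> in the literature; it is reflexive.\<close>

definition digit_le :: "nat \<Rightarrow> nat \<Rightarrow> nat \<Rightarrow> bool" where
  "digit_le p a b \<longleftrightarrow> (\<forall>j. digit p a j \<le> digit p b j)"

definition prec :: "nat \<Rightarrow> nat \<Rightarrow> nat \<Rightarrow> nat \<Rightarrow> bool" where
  "prec p q a b \<longleftrightarrow> digit_le p a b \<and> [a = b] (mod (q - 1))"

text \<open>The last step \<open>ns h <\<^sub>p n\<close> of a chain carries no congruence condition. For prime \<open>p\<close>
  the set below is finite, since \<open>ns 0, \<dots>, ns h\<close> are distinct and at most \<open>n\<close>,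
  and it contains \<open>0\<close>.\<close>

definition ht :: "nat \<Rightarrow> nat \<Rightarrow> nat \<Rightarrow> nat" where
  "ht p q n = Max {h. \<exists>ns :: nat \<Rightarrow> nat. ns 0 = 0 \<and> inj_on ns {0..h}
      \<and> (\<forall>i<h. prec p q (ns i) (ns (Suc i))) \<and> digit_le p (ns h) n}"

definition no_carry :: "nat \<Rightarrow> nat list \<Rightarrow> bool" where
  "no_carry p Xs \<longleftrightarrow> (\<forall>j. (\<Sum>X\<leftarrow>Xs. digit p X j) < p)"

text \<open>The tuple \<open>(X\<^sub>1, \<dots>, X\<^sub>i)\<close> is the list \<open>Xs\<close> with \<open>X\<^sub>k = Xs ! (k - 1)\<close>.\<close>

definition is_composition :: "nat \<Rightarrow> nat \<Rightarrow> nat \<Rightarrow> nat \<Rightarrow> nat list \<Rightarrow> bool" where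
  "is_composition p q n i Xs \<longleftrightarrow>
     length Xs = i \<and> (\<forall>X\<in>set Xs. 0 < X \<and> (q - 1) dvd X) \<and> sum_list Xs = n \<and> no_carry p Xs"

text \<open>The comparison is lexicographic from the last entry \<open>X\<^sub>h\<close> downwards, hence \<open>rev\<close>.\<close>

definition Sh :: "nat \<Rightarrow> nat \<Rightarrow> nat \<Rightarrow> nat list" where
  "Sh p q n = (THE Xs. is_composition p q n (ht p q n) Xs \<and>
     (\<forall>Ys. is_composition p q n (ht p q n) Ys \<longrightarrow>
        Ys = Xs \<or> (rev Ys, rev Xs) \<in> lexord {(x, y). x < y}))"

end

theory Submission
  imports Defs "HOL-Library.List_Lexorder"
begin

text \<open>
  Regard a number as the multiset of its units: \<open>p ^ j\<close> occurs as often as the \<open>j\<close>-th base-\<open>p\<close> digit says. Sums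
  without carry are unions of multisets, so compositions of \<open>n\<close> are partitions of its units. Modulo
  \<open>q - 1\<close> the unit \<open>p ^ j\<close> only depends on \<open>j\<close> modulo \<open>f\<close>. For an offset \<open>r\<close> give it the weight
  \<open>p ^ ((j + r) mod f)\<close>. Weights of numbers are congruent to \<open>p ^ r\<close> times the number, so a positive number is a
  multiple of \<open>q - 1\<close> if and only if its weight is, and then its weight is at least \<open>q - 1\<close>.

  Choose \<open>r\<close> such that the weight \<open>H * (q - 1)\<close> of \<open>n\<close> is minimal. Chains below \<open>n\<close> have length at most
  \<open>H\<close> (\<open>chain_length_le\<close>). Conversely, minimality bounds the share of the heavy units (\<open>heavy_part_bound\<close>), and
  this is just what the greedy distribution of the units into \<open>H\<close> bins of capacity \<open>q - 1\<close> needs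
  (\<open>greedy_bins\<close>). So the height is \<open>H\<close>, and in an \<open>H\<close>-composition every entry has weight exactly
  \<open>q - 1 = p ^ f - 1\<close> (\<open>composition_weight\<close>). Two neighbouring entries \<open>A = X\<^bsub>i+1\<^esub>\<close> and \<open>B = X\<^sub>i\<close> of the Sheats
  composition are therefore optimal under exchanges: parts of equal weight can be swapped between them, and no
  swap makes \<open>A\<close> larger.

  Suppose \<open>A < q * B\<close>. Multiplication by \<open>q\<close> moves digits up by \<open>f\<close> places and preserves weights. So there is \<open>c\<close>
  such that the digits of \<open>A\<close> above \<open>c + f\<close> are those of \<open>B\<close> above \<open>c\<close>, while \<open>A\<close> has the smaller digit at
  \<open>c + f\<close>. Exchanging single units of one class shows that no unit of \<open>A\<close> lies below a unit of \<open>B\<close> of the same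
  class. This confines a class that occurs in \<open>A\<close> above \<open>c + f\<close> to two positions, where \<open>A\<close> has at
  most \<open>p - 1\<close> units (\<open>class_sum_seen\<close>). As the weight of \<open>A\<close> is congruent to \<open>-1\<close> modulo all powers of \<open>p\<close>
  up to \<open>p ^ f\<close>, counting shows that \<open>A\<close> has exactly \<open>p - 1\<close> units of the class \<open>w\<close> of \<open>c\<close>, all at or above
  \<open>c + f\<close>. Hence \<open>B\<close> has at least \<open>p\<close> such units at or above \<open>c\<close>: a package of weight \<open>p ^ (w + 1)\<close> with a high
  largest unit (\<open>initial_package\<close>). By exchange, all units of \<open>A\<close> of class \<open>w + 1\<close> lie above that largest unit, where \<open>A\<close>
  copies \<open>B\<close>; so \<open>B\<close> has \<open>p - 1\<close> units of class \<open>w + 1\<close> to add to the package, and so on through all classes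
  (\<open>package_chain\<close>). In the end \<open>B\<close> contains a package of weight \<open>p ^ f\<close>, more than its own weight.\<close>

section \<open>Weights of digit functions\<close>

locale base_power =
  fixes p f :: nat
  assumes p_ge_2: "2 \<le> p" and f_ge_1: "1 \<le> f"
begin

text \<open>The residue class of the exponent \<open>j + r\<close> modulo \<open>f\<close>. The offset \<open>r\<close> amounts to replacing \<open>X\<close> by
  \<open>p ^ r * X\<close>, which does not affect divisibility by \<open>q - 1\<close>.\<close>

definition cls :: "nat \<Rightarrow> nat \<Rightarrow> nat" where
  "cls r j = (j + r) mod f"

text \<open>For the digit function \<open>d\<close> of a number \<open>X < p ^ N\<close>, this is the sum of the base-\<open>q\<close> digits of
  \<open>p ^ r * X\<close>.\<close>

definition wt :: "nat \<Rightarrow> nat \<Rightarrow> (nat \<Rightarrow> nat) \<Rightarrow> nat" where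
  "wt r N d = (\<Sum>j<N. d j * p ^ cls r j)"

definition val :: "nat \<Rightarrow> (nat \<Rightarrow> nat) \<Rightarrow> nat" where
  "val N d = (\<Sum>j<N. d j * p ^ j)"

lemma cls_less: "cls r j < f"
  using f_ge_1 by (simp add: cls_def)

lemma cls_add_period [simp]: "cls r (j + f) = cls r j"
  by (simp add: cls_def add.commute add.left_commute)

lemma cls_eq_imp_period_dvd:
  assumes "cls r i = cls r j" "i \<le> j"
  shows "f dvd j - i"
proof -
  have "(j + r) mod f = (i + r) mod f" using assms by (simp add: cls_def)
  hence "f dvd (j + r) - (i + r)" using assms(2) by (metis mod_eq_dvd_iff_nat add_le_mono1)
  thus ?thesis by simp
qed

text \<open>A window of \<open>f\<close> consecutive positions meets each class at most once. Every estimate on the number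
  of units of one class rests on this.\<close>

lemma cls_eq_imp_add_period_le:
  assumes "cls r i = cls r j" "i < j"
  shows "i + f \<le> j"
proof -
  have "f dvd j - i" using cls_eq_imp_period_dvd assms by simp
  hence "f \<le> j - i" using assms(2) by (simp add: dvd_imp_le)
  thus ?thesis using assms(2) by simp
qed

lemma wt_add: "wt r N (\<lambda>j. d j + e j) = wt r N d + wt r N e"
  by (simp add: wt_def distrib_right sum.distrib)

lemma val_add: "val N (\<lambda>j. d j + e j) = val N d + val N e"
  by (simp add: val_def distrib_right sum.distrib)

lemma wt_single: "i < N \<Longrightarrow> wt r N (\<lambda>j. if j = i then m else 0) = m * p ^ cls r i"
  by (simp add: wt_def if_distrib[of "\<lambda>x. x * _"] cong: if_cong)

lemma val_single: "i < N \<Longrightarrow> val N (\<lambda>j. if j = i then m else 0) = m * p ^ i"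
  by (simp add: val_def if_distrib[of "\<lambda>x. x * _"] cong: if_cong)

lemma wt_mono: "(\<And>j. d j \<le> e j) \<Longrightarrow> wt r N d \<le> wt r N e"
  unfolding wt_def by (intro sum_mono mult_right_mono) auto

lemma val_ge_power:
  assumes "i < N" "0 < d i"
  shows "p ^ i \<le> val N d"
proof -
  have "p ^ i \<le> d i * p ^ i" using assms by simp
  also have "\<dots> \<le> val N d" unfolding val_def
    using assms by (intro member_le_sum[of i "{..<N}" "\<lambda>j. d j * p ^ j"]) auto
  finally show ?thesis .
qed

lemma val_less_power:
  assumes "\<And>j. d j < p"
  shows "val N d < p ^ N"
proof (induction N)
  case (Suc N)
  have "val (Suc N) d = val N d + d N * p ^ N" by (simp add: val_def)
  also have "\<dots> < p ^ N + d N * p ^ N" using Suc by simp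
  also have "\<dots> = (d N + 1) * p ^ N" by (simp add: algebra_simps)
  also have "\<dots> \<le> p * p ^ N" using assms[of N] by (intro mult_right_mono) auto
  finally show ?case by simp
qed (simp add: val_def)

text \<open>Among the sub-multisets of weight at least \<open>p ^ w\<close>, take one of least weight. If it overshoots,
  let \<open>p ^ z\<close> be the weight of its lightest unit: all its units, and \<open>p ^ w\<close> itself, are multiples
  of \<open>p ^ z\<close>, so it overshoots by at least \<open>p ^ z\<close> and that unit can be dropped.\<close>

lemma exists_exact_subweight:
  assumes cl: "\<And>j. j < N \<Longrightarrow> 0 < d j \<Longrightarrow> cls r j \<le> w"
    and large: "p ^ w \<le> wt r N d"
  obtains s where "\<And>j. s j \<le> d j" "wt r N s = p ^ w"
proof -
  define P where "P m \<longleftrightarrow> (\<exists>s. (\<forall>j. s j \<le> d j) \<and> wt r N s = m \<and> p ^ w \<le> m)" for m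
  have "P (wt r N d)" using large by (auto simp: P_def)
  then obtain m where m: "P m" "\<And>k. P k \<Longrightarrow> m \<le> k"
    by (metis LeastI Least_le)
  then obtain s where s: "\<And>j. s j \<le> d j" "wt r N s = m" "p ^ w \<le> m"
    by (auto simp: P_def)
  have "m = p ^ w"
  proof (rule ccontr)
    assume "m \<noteq> p ^ w"
    hence gt: "p ^ w < m" using s(3) by simp
    have "{j. j < N \<and> 0 < s j} \<noteq> {}"
    proof
      assume "{j. j < N \<and> 0 < s j} = {}"
      hence "wt r N s = 0" by (auto simp: wt_def)
      thus False using gt s(2) by simp
    qed
    then obtain i where i: "i < N" "0 < s i"
      and imin: "\<And>j. j < N \<Longrightarrow> 0 < s j \<Longrightarrow> cls r i \<le> cls r j"
      using ex_has_least_nat[of "\<lambda>j. j < N \<and> 0 < s j" _ "cls r"] by blast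
    define z where "z = cls r i"
    have zw: "z \<le> w" using cl[of i] i s(1)[of i] by (simp add: z_def)
    have "p ^ z dvd s j * p ^ cls r j" if "j < N" for j
      using imin[OF that] by (cases "s j = 0") (auto simp: z_def le_imp_power_dvd)
    hence "p ^ z dvd wt r N s" unfolding wt_def by (intro dvd_sum) auto
    moreover have "p ^ z dvd p ^ w" using zw by (simp add: le_imp_power_dvd)
    ultimately have "p ^ z dvd m - p ^ w" using s(2) by simp
    hence le: "p ^ z \<le> m - p ^ w" using gt by (simp add: dvd_imp_le)
    define s' where "s' = (\<lambda>j. if j = i then s j - 1 else s j)"
    have "wt r N s = wt r N (\<lambda>j. s' j + (if j = i then 1 else 0))"
      using i by (intro arg_cong[of _ _ "wt r N"]) (auto simp: s'_def)
    also have "\<dots> = wt r N s' + p ^ z" unfolding wt_add using i by (simp add: wt_single z_def)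
    finally have "wt r N s' + p ^ z = m" using s(2) by simp
    moreover have "s' j \<le> d j" for j using s(1)[of j] by (auto simp: s'_def)
    ultimately have "P (m - p ^ z)" using le gt unfolding P_def
      by (intro exI[of _ s']) auto
    moreover have "0 < p ^ z" using p_ge_2 by simp
    ultimately show False using m(2)[of "m - p ^ z"] gt by linarith
  qed
  thus thesis using that s by blast
qed

end

section \<open>Exchange-optimal pairs\<close>

text \<open>Here \<open>a\<close> and \<open>b\<close> are to be the digit functions of two neighbouring entries \<open>X\<^bsub>i+1\<^esub>\<close> and \<open>X\<^sub>i\<close>.
  Swapping parts \<open>s\<close> and \<open>t\<close> of equal weight produces another composition, so lexicographic
  maximality forbids that such a swap enlarges \<open>X\<^bsub>i+1\<^esub>\<close>.\<close>

locale exchange_optimal = base_power +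
  fixes r N :: nat and a b :: "nat \<Rightarrow> nat"
  assumes no_carry: "a j + b j < p"
    and a_support: "N \<le> j \<Longrightarrow> a j = 0"
    and b_support: "N \<le> j \<Longrightarrow> b j = 0"
    and wt_a: "wt r N a = p ^ f - 1"
    and wt_b: "wt r N b = p ^ f - 1"
    and optimal: "\<lbrakk>\<And>j. s j \<le> a j; \<And>j. t j \<le> b j; wt r N s = wt r N t\<rbrakk> \<Longrightarrow> val N t \<le> val N s"
begin

definition cnt :: "nat \<Rightarrow> nat" where
  "cnt w = (\<Sum>j | j < N \<and> cls r j = w. a j)"

definition low :: "nat \<Rightarrow> nat" where
  "low w = (\<Sum>j | j < N \<and> cls r j < w. a j * p ^ cls r j)"

lemma low_Suc: "low (Suc w) = low w + cnt w * p ^ w"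
proof -
  have eq: "{j. j < N \<and> cls r j < Suc w} = {j. j < N \<and> cls r j < w} \<union> {j. j < N \<and> cls r j = w}"
    by auto
  show ?thesis unfolding low_def cnt_def eq
    by (subst sum.union_disjoint) (auto simp: sum_distrib_right)
qed

text \<open>The units of class at least \<open>w\<close> have weights divisible by \<open>p ^ w\<close>, and the total weight of \<open>a\<close> is
  \<open>p ^ f - 1\<close>, hence congruent to \<open>-1\<close> modulo \<open>p ^ w\<close>.\<close>

lemma power_dvd_low:
  assumes "w \<le> f"
  shows "p ^ w dvd low w + 1"
proof -
  have eq: "{..<N} = {j. j < N \<and> cls r j < w} \<union> {j. j < N \<and> w \<le> cls r j}" by auto
  have "wt r N a = low w + (\<Sum>j | j < N \<and> w \<le> cls r j. a j * p ^ cls r j)" (is "_ = _ + ?hi")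
    unfolding wt_def low_def by (subst eq, subst sum.union_disjoint) auto
  moreover have "0 < p ^ f" using p_ge_2 by simp
  ultimately have total: "p ^ f = (low w + 1) + ?hi" using wt_a by linarith
  have hi: "p ^ w dvd ?hi" by (intro dvd_sum) (auto intro: dvd_mult le_imp_power_dvd)
  have "p ^ w dvd p ^ f" using assms by (rule le_imp_power_dvd)
  hence "p ^ w dvd (low w + 1) + ?hi" unfolding total .
  thus ?thesis using hi by (simp only: dvd_add_left_iff)
qed

text \<open>Divisibility forces the number of units of class \<open>w\<close> to be congruent to \<open>-1\<close> modulo \<open>p\<close>, so an upper
  bound \<open>p - 1\<close> already determines it.\<close>

lemma low_step:
  assumes "low w + 1 = p ^ w" "w < f" "cnt w \<le> p - 1"
  shows "cnt w = p - 1" "low (Suc w) + 1 = p ^ Suc w"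
proof -
  have eq: "low (Suc w) + 1 = (cnt w + 1) * p ^ w" using assms(1) by (simp add: low_Suc)
  hence "p * p ^ w dvd (cnt w + 1) * p ^ w" using power_dvd_low[of "Suc w"] assms(2) by simp
  hence "p dvd cnt w + 1" using p_ge_2 by (subst (asm) dvd_times_right_cancel_iff) auto
  hence "p \<le> cnt w + 1" by (auto dest: dvd_imp_le)
  thus "cnt w = p - 1" using assms(3) by simp
  thus "low (Suc w) + 1 = p ^ Suc w" using eq p_ge_2 by simp
qed

lemma a_pos_less: "0 < a i \<Longrightarrow> i < N" using a_support[of i] by (cases "i < N") auto
lemma b_pos_less: "0 < b i \<Longrightarrow> i < N" using b_support[of i] by (cases "i < N") auto

text \<open>A package \<open>t\<close> of units of \<open>b\<close> may be traded for a single unit of \<open>a\<close> of the same weight. Its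
  largest unit alone bounds its value from below, so that unit cannot lie above the unit of \<open>a\<close>.\<close>

lemma unit_exchange:
  assumes i: "0 < a i" and t: "\<And>j. t j \<le> b j" and k: "0 < t k" and w: "wt r N t = p ^ cls r i"
  shows "k \<le> i"
proof -
  have kN: "k < N" using b_pos_less[of k] t[of k] k by simp
  have iN: "i < N" using a_pos_less i by blast
  have "p ^ k \<le> val N t" by (rule val_ge_power) fact+
  also have "\<dots> \<le> val N (\<lambda>j. if j = i then 1 else 0)"
    using i t w iN by (intro optimal) (auto simp: wt_single)
  also have "\<dots> = p ^ i" using iN by (simp add: val_single)
  finally show ?thesis using p_ge_2 by simp
qed

lemma same_class_order:
  assumes "0 < a i" "0 < b k" "cls r i = cls r k"
  shows "k \<le> i"
  using assms b_pos_less[of k]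
  by (intro unit_exchange[of i "\<lambda>j. if j = k then 1 else 0"]) (auto simp: wt_single)

end

section \<open>The inequality for an exchange-optimal pair\<close>

text \<open>With \<open>A\<close> and \<open>B\<close> the numbers having digits \<open>a\<close> and \<open>b\<close>, the failure of \<open>A \<ge> q * B\<close> means that the
  digits of \<open>A\<close> agree with those of \<open>q * B\<close>, which are the digits of \<open>b\<close> moved up by \<open>f\<close> places, above some
  position \<open>c + f\<close> and are smaller there. The lemmas below refute this situation.\<close>

locale first_difference = exchange_optimal +
  fixes c :: nat
  assumes differ: "a (c + f) < b c" and agree: "c < j \<Longrightarrow> a (j + f) = b j"
begin

lemma agree': "c + f < i \<Longrightarrow> a i = b (i - f)"
  using agree[of "i - f"] by simp

lemma cN: "c < N"
  using differ b_pos_less[of c] by simp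

text \<open>If the highest unit of class \<open>w\<close> in \<open>a\<close> sits at \<open>e > c + f\<close>, then \<open>b\<close> has a unit at \<open>e - f\<close>. Units of \<open>a\<close>
  never lie below units of \<open>b\<close> of the same class, so only \<open>e\<close> and \<open>e - f\<close> remain for \<open>a\<close>.\<close>

lemma class_support_top:
  assumes e: "0 < a e" "cls r e = w" "c + f < e"
    and top: "\<And>i. 0 < a i \<Longrightarrow> cls r i = w \<Longrightarrow> i \<le> e"
    and i: "0 < a i" "cls r i = w"
  shows "i = e \<or> i = e - f"
proof (rule ccontr)
  assume neg: "\<not> (i = e \<or> i = e - f)"
  have ef: "e - f + f = e" using e(3) by simp
  have cl: "cls r (e - f) = w" using cls_add_period[of r "e - f"] ef e(2) by simp
  have "0 < b (e - f)" using agree'[OF e(3)] e(1) by simp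
  hence "e - f \<le> i" using same_class_order[OF i(1)] cl i(2) by simp
  hence "e - f < i" "i < e" using neg top[OF i] by auto
  thus False using cls_eq_imp_add_period_le[of r "e - f" i] cl i(2) ef by simp
qed

lemma class_sum_top:
  assumes e: "0 < a e" "cls r e = w" "c + f < e"
    and top: "\<And>i. 0 < a i \<Longrightarrow> cls r i = w \<Longrightarrow> i \<le> e"
  shows "cnt w = a e + a (e - f)"
proof -
  have eN: "e < N" using a_pos_less e by blast
  have ef: "e - f + f = e" using e(3) by simp
  have cl: "cls r (e - f) = w" using cls_add_period[of r "e - f"] ef e(2) by simp
  have "cnt w = (\<Sum>j\<in>{e, e - f}. a j)" unfolding cnt_def
    using eN e(2) cl class_support_top[OF e top]
    by (intro sum.mono_neutral_right) (auto intro: ccontr)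
  also have "\<dots> = a e + a (e - f)" using e(3) f_ge_1 by (subst sum.insert) auto
  finally show ?thesis .
qed

lemma obtain_top:
  assumes "0 < a i" "cls r i = w"
  obtains e where "0 < a e" "cls r e = w" "i \<le> e" "\<And>j. 0 < a j \<Longrightarrow> cls r j = w \<Longrightarrow> j \<le> e"
proof -
  let ?S = "{j. 0 < a j \<and> cls r j = w}"
  have fin: "finite ?S" by (rule finite_subset[of _ "{..<N}"]) (use a_pos_less in auto)
  have "Max ?S \<in> ?S" using fin assms by (intro Max_in) auto
  thus thesis using that[of "Max ?S"] fin assms by (auto intro: Max_ge)
qed

text \<open>The digit of \<open>a\<close> at the top position \<open>e\<close> equals that of \<open>b\<close> at \<open>e - f\<close>. Hence the two digits of \<open>a\<close>
  counted by the previous lemma add up without carry.\<close>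

lemma class_sum_seen:
  assumes "0 < a i" "cls r i = w" "c + f < i"
  shows "cnt w \<le> p - 1"
proof -
  obtain e where e: "0 < a e" "cls r e = w" "i \<le> e" "\<And>j. 0 < a j \<Longrightarrow> cls r j = w \<Longrightarrow> j \<le> e"
    using obtain_top assms by metis
  have "cnt w = b (e - f) + a (e - f)"
    using class_sum_top[of e w] e assms(3) agree'[of e] by simp
  thus ?thesis using no_carry[of "e - f"] by simp
qed

text \<open>A class that occurs in \<open>a\<close> above \<open>c + f\<close> is covered by the previous lemma. Any other class
  distinct from that of \<open>c\<close> has just one position in the window between \<open>c\<close> and \<open>c + f\<close>.\<close>

lemma class_sum_above:
  assumes w: "w \<noteq> cls r c"
  shows "(\<Sum>j | j < N \<and> c \<le> j \<and> cls r j = w. a j) \<le> p - 1"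
proof (cases "\<exists>i. 0 < a i \<and> cls r i = w \<and> c + f < i")
  case True
  have "(\<Sum>j | j < N \<and> c \<le> j \<and> cls r j = w. a j) \<le> cnt w"
    unfolding cnt_def by (intro sum_mono2) auto
  moreover have "cnt w \<le> p - 1" using True class_sum_seen by blast
  ultimately show ?thesis by (rule order_trans)
next
  case False
  let ?S = "{j. j < N \<and> c \<le> j \<and> cls r j = w \<and> 0 < a j}"
  have below: "j < c + f" if "j \<in> ?S" for j
  proof -
    have "j \<noteq> c + f" using that w by auto
    moreover have "\<not> c + f < j" using that False by blast
    ultimately show ?thesis by linarith
  qed
  have uniq: "i = j" if "i \<in> ?S" "j \<in> ?S" for i j
  proof (rule ccontr)
    assume "i \<noteq> j"
    hence "i + f \<le> j \<or> j + f \<le> i"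
      using cls_eq_imp_add_period_le[of r i j] cls_eq_imp_add_period_le[of r j i] that
      by (cases "i < j") auto
    moreover have "c \<le> i" "c \<le> j" using that by auto
    ultimately show False using below[OF that(1)] below[OF that(2)] by linarith
  qed
  have "(\<Sum>j | j < N \<and> c \<le> j \<and> cls r j = w. a j) = (\<Sum>j\<in>?S. a j)"
    by (intro sum.mono_neutral_right) auto
  also have "\<dots> \<le> p - 1"
  proof (cases "?S = {}")
    case True thus ?thesis by simp
  next
    case False
    then obtain i where "?S = {i}" using uniq by blast
    thus ?thesis using no_carry[of i] by simp
  qed
  finally show ?thesis .
qed

text \<open>Otherwise some of these units would weigh exactly \<open>p ^ cls r c\<close> together and could be
  traded for the unit of \<open>b\<close> at position \<open>c\<close>, which lies above all of them.\<close>

lemma low_below_c: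
  "(\<Sum>j | j < c \<and> cls r j < cls r c. a j * p ^ cls r j) < p ^ cls r c"
proof (rule ccontr)
  assume neg: "\<not> ?thesis"
  define d where "d = (\<lambda>j. if j < c \<and> cls r j < cls r c then a j else 0)"
  have "wt r N d = (\<Sum>j | j < c \<and> cls r j < cls r c. d j * p ^ cls r j)"
    unfolding wt_def using cN by (intro sum.mono_neutral_right) (auto simp: d_def)
  also have "\<dots> = (\<Sum>j | j < c \<and> cls r j < cls r c. a j * p ^ cls r j)"
    by (intro sum.cong) (auto simp: d_def)
  finally have "p ^ cls r c \<le> wt r N d" using neg by simp
  moreover have "\<And>j. 0 < d j \<Longrightarrow> cls r j \<le> cls r c" by (auto simp: d_def split: if_splits)
  ultimately obtain s where s: "\<And>j. s j \<le> d j" "wt r N s = p ^ cls r c"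
    using exists_exact_subweight[of N d r "cls r c"] by blast
  have da: "d j \<le> a j" for j by (simp add: d_def)
  have "val N (\<lambda>j. if j = c then 1 else 0) \<le> val N s"
    using s da differ cN by (intro optimal) (auto simp: wt_single intro: order_trans)
  hence "p ^ c \<le> val N s" using cN by (simp add: val_single)
  also have "val N s = val c s"
  proof -
    have "s j = 0" if "\<not> j < c" for j using s(1)[of j] that by (simp add: d_def)
    thus ?thesis unfolding val_def using cN by (intro sum.mono_neutral_right) auto
  qed
  also have "\<dots> < p ^ c"
  proof (rule val_less_power)
    fix j show "s j < p" using s(1)[of j] da[of j] no_carry[of j] by simp
  qed
  finally show False by simp
qed

lemma power_geometric: "(\<Sum>w<m. (p - 1) * p ^ w) + 1 = p ^ m"
proof (induction m)
  case (Suc m)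
  have "(\<Sum>w<Suc m. (p - 1) * p ^ w) + 1 = (1 + (p - 1)) * p ^ m"
    using Suc by (simp add: distrib_right)
  also have "1 + (p - 1) = p" using p_ge_2 by simp
  finally show ?case by simp
qed simp

text \<open>The units at or above \<open>c\<close> contribute at most \<open>p - 1\<close> per class, those below \<open>c\<close> less than
  \<open>p ^ cls r c\<close>. The sum is therefore too small for any value congruent to \<open>-1\<close> modulo \<open>p ^ cls r c\<close> other than
  the least one.\<close>

lemma low_c: "low (cls r c) + 1 = p ^ cls r c"
proof -
  let ?w = "cls r c"
  let ?hi = "\<Sum>j | j < N \<and> c \<le> j \<and> cls r j < ?w. a j * p ^ cls r j"
  let ?lo = "\<Sum>j | j < c \<and> cls r j < ?w. a j * p ^ cls r j"
  have eq: "{j. j < N \<and> cls r j < ?w} = {j. j < c \<and> cls r j < ?w} \<union> {j. j < N \<and> c \<le> j \<and> cls r j < ?w}"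
    using cN by auto
  have split: "low ?w = ?lo + ?hi"
    unfolding low_def by (subst eq, subst sum.union_disjoint) auto
  have "?hi = (\<Sum>w<?w. \<Sum>j | j \<in> {j. j < N \<and> c \<le> j \<and> cls r j < ?w} \<and> cls r j = w. a j * p ^ cls r j)"
    by (intro sum.group[symmetric]) auto
  also have "\<dots> = (\<Sum>w<?w. (\<Sum>j | j < N \<and> c \<le> j \<and> cls r j = w. a j) * p ^ w)"
    by (auto simp: sum_distrib_right intro!: sum.cong)
  also have "\<dots> \<le> (\<Sum>w<?w. (p - 1) * p ^ w)"
    by (intro sum_mono mult_right_mono class_sum_above) auto
  finally have "?hi + 1 \<le> p ^ ?w" using power_geometric[of ?w] by linarith
  with split low_below_c have lt: "low ?w + 1 < p ^ ?w * 2" by linarith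
  have "p ^ ?w dvd low ?w + 1" using cls_less[of r c] by (intro power_dvd_low) simp
  then obtain m where m: "low ?w + 1 = p ^ ?w * m" by (elim dvdE)
  hence "m < 2" using lt p_ge_2 by simp
  moreover have "m \<noteq> 0" using m by (intro notI) simp
  ultimately have "m = 1" by simp
  thus ?thesis using m by simp
qed


text \<open>If \<open>a\<close> had no unit of the class of \<open>c\<close> above \<open>c + f\<close>, all its units of this class would lie at \<open>c\<close> or
  \<open>c + f\<close>. As \<open>a (c + f) < b c\<close>, there would be fewer than \<open>p - 1\<close> of them, which \<open>low_step\<close> excludes.\<close>

lemma class_c_seen: "cnt (cls r c) = p - 1" "\<exists>i. 0 < a i \<and> cls r i = cls r c \<and> c + f < i"
proof -
  let ?w = "cls r c"
  have main: "(\<exists>i. 0 < a i \<and> cls r i = ?w \<and> c + f < i) \<or> cnt ?w < p - 1"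
  proof (rule disjCI)
    assume "\<not> cnt ?w < p - 1"
    show "\<exists>i. 0 < a i \<and> cls r i = ?w \<and> c + f < i"
    proof (rule ccontr)
      assume no: "\<not> ?thesis"
      have sub: "j = c \<or> j = c + f" if "0 < a j" "cls r j = ?w" for j
      proof -
        have "c \<le> j" using same_class_order[of j c] that differ by simp
        moreover have "j \<le> c + f" using no that by (meson not_le)
        moreover have "j = c \<or> c + f \<le> j"
          using cls_eq_imp_add_period_le[of r c j] that(2) \<open>c \<le> j\<close> by linarith
        ultimately show ?thesis by auto
      qed
      have "cnt ?w = (\<Sum>j | j < N \<and> cls r j = ?w \<and> 0 < a j. a j)"
        unfolding cnt_def by (intro sum.mono_neutral_right) auto
      also have "\<dots> \<le> (\<Sum>j\<in>{c, c + f}. a j)"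
        by (rule sum_mono2) (use sub in auto)
      also have "\<dots> = a c + a (c + f)" using f_ge_1 by simp
      also have "\<dots> < p - 1" using differ no_carry[of c] by linarith
      finally show False using \<open>\<not> cnt ?w < p - 1\<close> by simp
    qed
  qed
  hence "cnt ?w \<le> p - 1" using class_sum_seen less_imp_le by blast
  thus eq: "cnt ?w = p - 1" using low_step(1)[OF low_c cls_less] by simp
  show "\<exists>i. 0 < a i \<and> cls r i = ?w \<and> c + f < i" using main eq by simp
qed

text \<open>The \<open>p - 1\<close> units of this class in \<open>a\<close> all lie at or above \<open>c + f\<close>, so \<open>b\<close> has a copy of them \<open>f\<close> places
  lower, plus one further unit at \<open>c\<close> because the digits differ there. These \<open>p\<close> units of \<open>b\<close> form a
  package that weighs as much as one unit of the next class.\<close>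

lemma initial_package:
  obtains k t where "c + f \<le> k" "cls r k = cls r c" "\<And>j. t j \<le> b j" "0 < t k"
    "wt r N t = p ^ Suc (cls r c)" "\<And>j. 0 < t j \<Longrightarrow> cls r j = cls r c"
proof -
  let ?w = "cls r c"
  obtain i where i: "0 < a i" "cls r i = ?w" "c + f < i" using class_c_seen(2) by blast
  obtain e where e: "0 < a e" "cls r e = ?w" "i \<le> e"
    "\<And>j. 0 < a j \<Longrightarrow> cls r j = ?w \<Longrightarrow> j \<le> e"
    using obtain_top[OF i(1,2)] by blast
  have "c + f < e" using i(3) e(3) by simp
  note e = e(1,2) this e(4)
  define k where "k = e - f"
  have ek: "e = k + f" using e(3) by (simp add: k_def)
  have clk: "cls r k = ?w" using e(2) ek by simp
  have "c + f \<le> k" using cls_eq_imp_add_period_le[of r c k] clk e(3) ek by simp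
  define l where "l = k - f"
  have kl: "k = l + f" using \<open>c + f \<le> k\<close> by (simp add: l_def)
  have cll: "cls r l = ?w" using clk kl by simp
  have cl: "c \<le> l" using \<open>c + f \<le> k\<close> kl by simp
  have sum: "a e + a k = p - 1"
    using class_sum_top[OF e(1-3)] e(4) class_c_seen(1) by (simp add: k_def)
  have bk: "b k = a e" using agree[of k] ek e(3) by simp
  have lN: "l < N" "k < N" "k \<noteq> l" using kl b_pos_less[of k] bk e(1) f_ge_1 by auto
  \<comment> \<open>The positions \<open>l\<close> and \<open>c\<close> may coincide; then the contributions \<open>a k\<close> and \<open>1\<close> add up there.\<close>
  define t where "t = (\<lambda>j. ((if j = k then a e else 0) + (if j = l then a k else 0)) + (if j = c then 1 else 0))"
  have "wt r N t = a e * p ^ ?w + a k * p ^ ?w + p ^ ?w"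
    unfolding t_def wt_add using lN cN clk cll by (simp add: wt_single)
  also have "\<dots> = (a e + a k + 1) * p ^ ?w" by (simp add: algebra_simps)
  also have "a e + a k + 1 = p" using sum p_ge_2 by simp
  finally have wt: "wt r N t = p ^ Suc ?w" by simp
  have "t j \<le> b j" for j
  proof -
    have "a k + 1 \<le> b l" if "l = c" using that differ kl by simp
    moreover have "a k = b l" if "l \<noteq> c" using that cl agree[of l] kl by simp
    moreover have "k \<noteq> c" using e(3) ek by simp
    ultimately show ?thesis using bk lN(3) differ by (auto simp: t_def)
  qed
  moreover have "0 < t k" using e(1) by (simp add: t_def)
  moreover have "\<And>j. 0 < t j \<Longrightarrow> cls r j = ?w"
    using clk cll by (auto simp: t_def split: if_splits)
  ultimately show thesis by (rule that[OF \<open>c + f \<le> k\<close> clk _ _ wt])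
qed

text \<open>A package of weight \<open>p ^ w\<close> in \<open>b\<close> that contains the high unit \<open>k\<close> pushes all units of class \<open>w\<close> in \<open>a\<close>
  above \<open>k\<close>, by \<open>unit_exchange\<close>. There \<open>a\<close> is a shifted copy of \<open>b\<close>: so \<open>a\<close> has exactly \<open>p - 1\<close> units
  of class \<open>w\<close>, their copies in \<open>b\<close> join the package, and its weight becomes \<open>p ^ (w + 1)\<close>.\<close>

lemma package_chain:
  assumes k: "c + f \<le> k" "cls r k = cls r c"
    and start: "\<exists>t. (\<forall>j. t j \<le> b j) \<and> 0 < t k \<and> wt r N t = p ^ Suc (cls r c) \<and> (\<forall>j. 0 < t j \<longrightarrow> cls r j < Suc (cls r c))"
    and w: "Suc (cls r c) \<le> w" "w \<le> f"
  shows "low w + 1 = p ^ w \<and>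
    (\<exists>t. (\<forall>j. t j \<le> b j) \<and> 0 < t k \<and> wt r N t = p ^ w \<and> (\<forall>j. 0 < t j \<longrightarrow> cls r j < w))"
  using w
proof (induction w rule: dec_induct)
  case base
  have "low (Suc (cls r c)) + 1 = p ^ Suc (cls r c)"
    using low_step(2)[OF low_c cls_less] class_c_seen(1) by simp
  thus ?case using start by simp
next
  case (step w)
  then obtain t where t: "\<And>j. t j \<le> b j" "0 < t k" "wt r N t = p ^ w" "\<And>j. 0 < t j \<Longrightarrow> cls r j < w"
    by auto
  have low: "low w + 1 = p ^ w" and wf: "w < f" using step by auto
  have above: "c + f < i" if "0 < a i" "cls r i = w" for i
  proof -
    have "k \<le> i" using unit_exchange[of i t k] t that by simp
    moreover have "k \<noteq> i" using that(2) k(2) step(1) by auto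
    ultimately show ?thesis using k(1) by simp
  qed
  have "cnt w \<le> p - 1"
  proof (cases "\<exists>i. 0 < a i \<and> cls r i = w")
    case True
    thus ?thesis using above class_sum_seen by blast
  next
    case False
    hence "cnt w = 0" unfolding cnt_def by (intro sum.neutral) auto
    thus ?thesis by simp
  qed
  note ls = low_step[OF low wf this]
  define u where "u = (\<lambda>j. if cls r j = w then a (j + f) else 0)"
  have u_le: "u j \<le> b j" for j
  proof (cases "0 < u j")
    case True
    hence "c < j" using above[of "j + f"] by (auto simp: u_def split: if_splits)
    thus ?thesis using agree[of j] by (simp add: u_def)
  qed simp
  have "wt r N u = (\<Sum>j<N. u j) * p ^ w"
    unfolding wt_def sum_distrib_right by (intro sum.cong) (auto simp: u_def)
  also have "(\<Sum>j<N. u j) = (\<Sum>j | j < N \<and> cls r j = w \<and> 0 < a (j + f). a (j + f))"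
    by (intro sum.mono_neutral_cong_right) (auto simp: u_def)
  also have "\<dots> = (\<Sum>i | i < N \<and> cls r i = w \<and> 0 < a i. a i)"
  proof (rule sum.reindex_bij_witness[of _ "\<lambda>i. i - f" "\<lambda>j. j + f"])
    fix i assume i: "i \<in> {i. i < N \<and> cls r i = w \<and> 0 < a i}"
    hence "f \<le> i" using above[of i] by simp
    thus "i - f + f = i" by simp
    hence "cls r (i - f) = cls r i" using cls_add_period[of r "i - f"] by simp
    thus "i - f \<in> {j. j < N \<and> cls r j = w \<and> 0 < a (j + f)}" using i \<open>i - f + f = i\<close> by simp
  qed (use a_pos_less in auto)
  also have "\<dots> = cnt w" unfolding cnt_def by (intro sum.mono_neutral_left) auto
  finally have wu: "wt r N u = (p - 1) * p ^ w" using ls(1) by simp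
  define t' where "t' = (\<lambda>j. t j + u j)"
  have "wt r N t' = p ^ w + (p - 1) * p ^ w" unfolding t'_def wt_add wu t(3) ..
  also have "\<dots> = (1 + (p - 1)) * p ^ w" by (simp only: distrib_right mult_1)
  also have "1 + (p - 1) = p" using p_ge_2 by simp
  finally have "wt r N t' = p ^ Suc w" by simp
  moreover have "t' j \<le> b j" for j
  proof (cases "cls r j = w")
    case True
    hence "t j = 0" using t(4)[of j] by auto
    thus ?thesis using u_le by (simp add: t'_def)
  next
    case False
    thus ?thesis using t(1) by (simp add: t'_def u_def)
  qed
  moreover have "0 < t' k" using t(2) by (simp add: t'_def)
  moreover have "cls r j < Suc w" if "0 < t' j" for j
    using that t(4)[of j] by (cases "t j = 0") (auto simp: t'_def u_def split: if_splits)
  ultimately show ?case using ls(2) by blast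
qed

text \<open>At class \<open>f\<close> the package would outweigh \<open>b\<close>, whose weight is only \<open>p ^ f - 1\<close>.\<close>

lemma impossible: False
proof -
  obtain k t where "c + f \<le> k" "cls r k = cls r c" "\<And>j. t j \<le> b j" "0 < t k"
    "wt r N t = p ^ Suc (cls r c)" "\<And>j. 0 < t j \<Longrightarrow> cls r j = cls r c"
    using initial_package by blast
  hence "\<exists>t. (\<forall>j. t j \<le> b j) \<and> wt r N t = p ^ f"
    using package_chain[of k f] cls_less[of r c] by (metis Suc_leI lessI order_refl)
  then obtain t where "\<And>j. t j \<le> b j" "wt r N t = p ^ f" by blast
  hence "p ^ f \<le> wt r N b" by (metis wt_mono)
  hence "p ^ f \<le> p ^ f - 1" unfolding wt_b .
  moreover have "0 < p ^ f" using p_ge_2 by simp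
  ultimately show False by linarith
qed

end

section \<open>Base-\<open>p\<close> digits and residues modulo \<open>q - 1\<close>\<close>

context base_power
begin

lemma digit_less: "digit p x j < p"
  using p_ge_2 by (simp add: digit_def)

lemma digit_zero [simp]: "digit p 0 j = 0"
  by (simp add: digit_def)

lemma digit_add_high:
  assumes "x < p ^ N"
  shows "digit p (x + m * p ^ N) i = (if i < N then digit p x i else digit p m (i - N))"
proof (cases "i < N")
  case True
  have "p ^ N = p ^ (N - Suc i + Suc i)" using True by simp
  also have "\<dots> = p ^ (N - Suc i) * p * p ^ i" by (simp only: power_add power_Suc mult_ac)
  finally have "p ^ N = p ^ (N - Suc i) * p * p ^ i" .
  hence "(x + m * p ^ N) div p ^ i = x div p ^ i + m * p ^ (N - Suc i) * p"
    using p_ge_2 by (simp flip: mult.assoc)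
  thus ?thesis using True by (simp add: digit_def)
next
  case False
  hence "p ^ i = p ^ N * p ^ (i - N)" by (simp flip: power_add)
  hence "(x + m * p ^ N) div p ^ i = m div p ^ (i - N)"
    using assms p_ge_2 by (simp add: div_mult2_eq)
  thus ?thesis using False by (simp add: digit_def)
qed

lemma digit_eq_0: "x < p ^ N \<Longrightarrow> N \<le> j \<Longrightarrow> digit p x j = 0"
  using digit_add_high[of x N 0 j] by simp

lemma digit_below: "d < p \<Longrightarrow> digit p d j = (if j = 0 then d else 0)"
  using digit_eq_0[of d 1 j] by (auto simp: digit_def)

lemma digit_mod_div:
  "digit p x j = (if j < N then digit p (x mod p ^ N) j else digit p (x div p ^ N) (j - N))"
  using digit_add_high[of "x mod p ^ N" N "x div p ^ N" j] p_ge_2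
  unfolding mod_div_mult_eq by simp

lemma digit_val:
  assumes "\<And>j. d j < p"
  shows "digit p (val N d) i = (if i < N then d i else 0)"
proof (induction N)
  case (Suc N)
  have "val (Suc N) d = val N d + d N * p ^ N" by (simp add: val_def)
  moreover have "digit p (val N d + d N * p ^ N) i
      = (if i < N then digit p (val N d) i else digit p (d N) (i - N))"
    by (intro digit_add_high val_less_power assms)
  ultimately show ?case using Suc digit_below[of "d N" "i - N"] assms[of N]
    by (auto simp: less_Suc_eq)
qed (simp add: val_def)

lemma val_digit: "x < p ^ N \<Longrightarrow> val N (digit p x) = x"
proof (induction N arbitrary: x)
  case (Suc N)
  have "x div p ^ N < p" using Suc.prems by (simp add: less_mult_imp_div_less)
  hence top: "digit p x N = x div p ^ N" by (simp add: digit_def)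
  have "val N (digit p x) = val N (digit p (x mod p ^ N))"
    unfolding val_def by (intro sum.cong) (auto simp: digit_mod_div[of x _ N])
  also have "\<dots> = x mod p ^ N" using p_ge_2 by (intro Suc.IH) simp
  finally show ?case using top by (simp add: val_def mod_div_mult_eq)
qed (simp add: val_def)

text \<open>Comparing numbers is comparing digits from the top; for \<open>A < q * B\<close> this yields the position on
  which the locale \<open>first_difference\<close> is built.\<close>

lemma less_imp_top_digit_less:
  assumes "x < y"
  obtains i where "digit p x i < digit p y i" "\<And>j. i < j \<Longrightarrow> digit p x j = digit p y j"
proof -
  have "\<exists>i. digit p x i < digit p y i \<and> (\<forall>j>i. digit p x j = digit p y j)"
    if "y < p ^ N" "x < y" for N x y
    using that
  proof (induction N arbitrary: x y)
    case (Suc N)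
    show ?case
    proof (cases "x div p ^ N = y div p ^ N")
      case True
      have "x mod p ^ N < y mod p ^ N"
        using Suc.prems(2) True by (metis div_mult_mod_eq nat_add_left_cancel_less)
      moreover have "y mod p ^ N < p ^ N" using p_ge_2 by simp
      ultimately obtain i where i: "digit p (x mod p ^ N) i < digit p (y mod p ^ N) i"
        "\<And>j. i < j \<Longrightarrow> digit p (x mod p ^ N) j = digit p (y mod p ^ N) j"
        using Suc.IH by blast
      have "i < N" using i(1) digit_eq_0[OF \<open>y mod p ^ N < p ^ N\<close>, of i] by (cases "i < N") auto
      thus ?thesis using i True
        by (intro exI[of _ i]) (auto simp: digit_mod_div[of x _ N] digit_mod_div[of y _ N])
    next
      case False
      have le: "x div p ^ N < y div p ^ N"
        using False Suc.prems(2) by (simp add: div_le_mono le_neq_implies_less less_imp_le)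
      moreover have "y div p ^ N < p" using Suc.prems(1) by (simp add: less_mult_imp_div_less)
      ultimately have "digit p x N < digit p y N" by (simp add: digit_def)
      moreover have "digit p x j = digit p y j" if "N < j" for j
        using digit_eq_0[of x "Suc N" j] digit_eq_0[of y "Suc N" j] Suc.prems that by simp
      ultimately show ?thesis by blast
    qed
  qed simp
  moreover have "y < p ^ y" using p_ge_2 by (simp add: power_gt_expt)
  ultimately show thesis using assms that by blast
qed

lemma digit_power_mult: "digit p (p ^ m * x) j = (if j < m then 0 else digit p x (j - m))"
  using digit_add_high[of 0 m x j] p_ge_2 by (simp add: mult.commute)

lemma digit_le_imp_le:
  assumes "digit_le p x y"
  shows "x \<le> y"
proof (rule ccontr)
  assume "\<not> x \<le> y"
  hence "y < x" by simp
  then obtain i where "digit p y i < digit p x i" by (rule less_imp_top_digit_less)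
  thus False using assms by (simp add: digit_le_def leD)
qed

lemma digit_sum_list:
  assumes "no_carry p Xs"
  shows "digit p (sum_list Xs) j = (\<Sum>X\<leftarrow>Xs. digit p X j)"
proof -
  \<comment> \<open>Any large bound will do; this one also makes \<open>j < N\<close>.\<close>
  define N where "N = Suc (sum_list Xs + j)"
  have "k < p ^ k" for k using p_ge_2 by (simp add: power_gt_expt)
  moreover have "p ^ sum_list Xs \<le> p ^ N" using p_ge_2 by (intro power_increasing) (auto simp: N_def)
  ultimately have "sum_list Xs < p ^ N" by (meson less_le_trans)
  moreover have "sum_list Ys = val N (\<lambda>j. \<Sum>X\<leftarrow>Ys. digit p X j)"
    if "sum_list Ys < p ^ N" for Ys
    using that
  proof (induction Ys)
    case Nil
    thus ?case by (simp add: val_def)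
  next
    case (Cons X Ys)
    thus ?case by (simp add: val_add val_digit)
  qed
  ultimately have "sum_list Xs = val N (\<lambda>j. \<Sum>X\<leftarrow>Xs. digit p X j)" by blast
  thus ?thesis using assms digit_val[of "\<lambda>j. \<Sum>X\<leftarrow>Xs. digit p X j" N j]
    by (simp add: no_carry_def N_def)
qed

lemma power_cls_cong: "[p ^ cls r j = p ^ (j + r)] (mod (p ^ f - 1))"
proof -
  have "[p ^ f - 1 + 1 = 0 + 1] (mod (p ^ f - 1))" by (intro cong_add) (auto simp: cong_def)
  moreover have "0 < p ^ f" using p_ge_2 by simp
  ultimately have "[p ^ f = 1] (mod (p ^ f - 1))" by simp
  hence "[(p ^ f) ^ ((j + r) div f) * p ^ cls r j = 1 ^ ((j + r) div f) * p ^ cls r j] (mod (p ^ f - 1))"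
    by (intro cong_mult cong_pow) auto
  moreover have "(p ^ f) ^ ((j + r) div f) * p ^ cls r j = p ^ (j + r)"
    by (simp add: cls_def flip: power_mult power_add)
  ultimately show ?thesis by (simp add: cong_sym)
qed

lemma wt_cong:
  assumes "x < p ^ N"
  shows "[wt r N (digit p x) = p ^ r * x] (mod (p ^ f - 1))"
proof -
  have "[wt r N (digit p x) = (\<Sum>j<N. digit p x j * p ^ (j + r))] (mod (p ^ f - 1))"
    unfolding wt_def by (intro cong_sum cong_mult power_cls_cong) auto
  also have "(\<Sum>j<N. digit p x j * p ^ (j + r)) = p ^ r * val N (digit p x)"
    by (simp add: val_def sum_distrib_left power_add mult_ac)
  finally show ?thesis using val_digit[OF assms] by simp
qed

lemma coprime_period: "coprime (p ^ f - 1) (p ^ r)"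
proof -
  have "coprime (p ^ f - 1) (p ^ f)" by (rule coprime_diff_one_left_nat) (use p_ge_2 in simp)
  hence "coprime (p ^ f - 1) p" using f_ge_1 by simp
  thus ?thesis by simp
qed

lemma dvd_wt_iff:
  assumes "x < p ^ N"
  shows "p ^ f - 1 dvd wt r N (digit p x) \<longleftrightarrow> p ^ f - 1 dvd x"
proof -
  have "p ^ f - 1 dvd wt r N (digit p x) \<longleftrightarrow> p ^ f - 1 dvd p ^ r * x"
    using wt_cong[OF assms] by (rule cong_dvd_iff)
  also have "\<dots> \<longleftrightarrow> p ^ f - 1 dvd x" by (rule coprime_dvd_mult_right_iff[OF coprime_period])
  finally show ?thesis .
qed

lemma period_pos: "0 < p ^ f - 1"
proof -
  have "1 < p ^ f" using p_ge_2 f_ge_1 by (intro one_less_power) auto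
  thus ?thesis by simp
qed

text \<open>The weight is congruent to \<open>p ^ r * x\<close>, hence a positive multiple of \<open>q - 1\<close>.\<close>

lemma wt_ge_period:
  assumes "x < p ^ N" "0 < x" "p ^ f - 1 dvd x"
  shows "p ^ f - 1 \<le> wt r N (digit p x)"
proof -
  have "val N (digit p x) \<noteq> 0" using val_digit assms by simp
  hence "wt r N (digit p x) \<noteq> 0" using p_ge_2 by (auto simp: val_def wt_def)
  thus ?thesis using dvd_wt_iff[OF assms(1)] assms(3) by (simp add: dvd_imp_le)
qed

lemma wt_sum_list: "wt r N (\<lambda>j. \<Sum>X\<leftarrow>Xs. digit p X j) = (\<Sum>X\<leftarrow>Xs. wt r N (digit p X))"
  by (induction Xs) (simp_all add: wt_add, simp add: wt_def)

section \<open>The minimal rotation and the height\<close>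

lemma cls_rotate:
  assumes "v \<le> f"
  shows "cls (r + (f - v)) j = (if v \<le> cls r j then cls r j - v else cls r j + (f - v))"
proof -
  have eq: "cls (r + (f - v)) j = (cls r j + (f - v)) mod f"
    by (simp add: cls_def mod_add_left_eq add.assoc)
  have lt: "cls r j < f" by (rule cls_less)
  show ?thesis
  proof (cases "v \<le> cls r j")
    case True
    hence "cls r j + (f - v) = (cls r j - v) + f" using assms by simp
    hence "cls (r + (f - v)) j = (cls r j - v + f) mod f" using eq by (simp only:)
    also have "\<dots> = cls r j - v" using lt by simp
    finally show ?thesis using True by (simp only: if_True)
  next
    case False
    thus ?thesis using eq lt by simp
  qed
qed

text \<open>Rotating by \<open>f - v\<close> further places turns the units of class at least \<open>v\<close> into units lighter by the factor
  \<open>p ^ v\<close> and makes the others heavier by \<open>p ^ (f - v)\<close>. Since this does not lower the total weight, the heavy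
  units cannot dominate.\<close>

lemma heavy_part_bound:
  assumes minimal: "\<And>r'. wt r N d \<le> wt r' N d"
    and W: "wt r N d = H * (p ^ f - 1)" and v: "v < f"
  shows "(\<Sum>j | j < N \<and> v \<le> cls r j. d j * p ^ cls r j) \<le> H * (p ^ f - p ^ v)"
proof -
  let ?hi = "\<Sum>j | j < N \<and> v \<le> cls r j. d j * p ^ cls r j"
  let ?lo = "\<Sum>j | j < N \<and> cls r j < v. d j * p ^ cls r j"
  define r' where "r' = r + (f - v)"
  have rot: "cls r' j = (if v \<le> cls r j then cls r j - v else cls r j + (f - v))" for j
    unfolding r'_def using v by (intro cls_rotate) simp
  have eq: "{..<N} = {j. j < N \<and> v \<le> cls r j} \<union> {j. j < N \<and> cls r j < v}" by auto
  have split: "(\<Sum>j<N. g j) = (\<Sum>j | j < N \<and> v \<le> cls r j. g j) + (\<Sum>j | j < N \<and> cls r j < v. g j)"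
    for g :: "nat \<Rightarrow> nat"
    by (subst eq, subst sum.union_disjoint) auto
  have hilo: "wt r N d = ?hi + ?lo" unfolding wt_def by (rule split)
  have up: "p ^ v * p ^ cls r' j = p ^ cls r j" if "v \<le> cls r j" for j
    using that v by (simp add: rot flip: power_add)
  have down: "p ^ v * p ^ cls r' j = p ^ f * p ^ cls r j" if "cls r j < v" for j
    using that v by (simp add: rot add.commute flip: power_add)
  have "p ^ v * wt r' N d = (\<Sum>j<N. d j * (p ^ v * p ^ cls r' j))"
    by (simp add: wt_def sum_distrib_left mult_ac)
  also have "\<dots> = (\<Sum>j | j < N \<and> v \<le> cls r j. d j * (p ^ v * p ^ cls r' j))
      + (\<Sum>j | j < N \<and> cls r j < v. d j * (p ^ v * p ^ cls r' j))" by (rule split)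
  also have "(\<Sum>j | j < N \<and> v \<le> cls r j. d j * (p ^ v * p ^ cls r' j)) = ?hi"
    by (intro sum.cong) (auto simp: up)
  also have "(\<Sum>j | j < N \<and> cls r j < v. d j * (p ^ v * p ^ cls r' j)) = p ^ f * ?lo"
    by (simp add: down sum_distrib_left mult_ac)
  finally have "p ^ v * wt r N d \<le> ?hi + p ^ f * ?lo"
    using mult_le_mono2[OF minimal[of r'], of "p ^ v"] by simp
  hence "p ^ v * wt r N d + p ^ f * ?hi \<le> ?hi + p ^ f * wt r N d"
    unfolding hilo by (simp add: distrib_left)
  moreover have "p ^ f * ?hi = (p ^ f - 1) * ?hi + ?hi"
    using period_pos by (simp add: diff_mult_distrib)
  ultimately have "(p ^ f - 1) * ?hi \<le> (p ^ f - p ^ v) * wt r N d"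
    unfolding diff_mult_distrib[of "p ^ f" "p ^ v"] by linarith
  also have "\<dots> = (p ^ f - 1) * (H * (p ^ f - p ^ v))"
    unfolding W by (simp only: mult_ac)
  finally show ?thesis using period_pos by simp
qed

text \<open>Put the units into \<open>H\<close> bins of capacity \<open>q - 1\<close>, the heaviest first. If a unit of weight \<open>p ^ v\<close> fits into no bin, each
  bin is loaded with at least \<open>q - p ^ v\<close> by units of class at least \<open>v\<close>; together with the present unit
  these exceed the assumed bound.\<close>

lemma greedy_bins:
  fixes \<omega> :: "'a \<Rightarrow> nat"
  assumes fin: "finite U" and small: "\<And>u. u \<in> U \<Longrightarrow> \<omega> u < f"
    and heavy: "\<And>u. u \<in> U \<Longrightarrow> (\<Sum>x | x \<in> U \<and> \<omega> u \<le> \<omega> x. p ^ \<omega> x) \<le> H * (p ^ f - p ^ \<omega> u)"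
  shows "\<exists>g. (\<forall>u\<in>U. g u < H) \<and> (\<forall>i<H. (\<Sum>x | x \<in> U \<and> g x = i. p ^ \<omega> x) \<le> p ^ f - 1)"
proof -
  have "S \<subseteq> U \<longrightarrow> (\<exists>g. (\<forall>u\<in>S. g u < H) \<and> (\<forall>i<H. (\<Sum>x | x \<in> S \<and> g x = i. p ^ \<omega> x) \<le> p ^ f - 1))"
    if "finite S" for S
    using that
  \<comment> \<open>This ranking inserts elements in order of decreasing weight.\<close>
  proof (induction S rule: finite_ranking_induct[where f = "\<lambda>u. f - \<omega> u"])
    case (insert u S)
    show ?case
    proof (cases "u \<in> S")
      case True
      thus ?thesis using insert.IH by (simp add: insert_absorb)
    next
      case notin: False
      show ?thesis
      proof
        assume sub: "insert u S \<subseteq> U"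
        then obtain g where g: "\<And>x. x \<in> S \<Longrightarrow> g x < H"
          "\<And>i. i < H \<Longrightarrow> (\<Sum>x | x \<in> S \<and> g x = i. p ^ \<omega> x) \<le> p ^ f - 1"
          using insert.IH by auto
        let ?load = "\<lambda>i. \<Sum>x | x \<in> S \<and> g x = i. p ^ \<omega> x"
        have total: "(\<Sum>i<H. ?load i) = (\<Sum>x\<in>S. p ^ \<omega> x)"
          using insert.hyps(1) g(1) by (intro sum.group) auto
        have "S \<subseteq> {x. x \<in> U \<and> \<omega> u \<le> \<omega> x}"
        proof
          fix x assume "x \<in> S"
          thus "x \<in> {x. x \<in> U \<and> \<omega> u \<le> \<omega> x}"
            using insert.hyps(2)[of x] sub small[of x] small[of u] by auto
        qed
        hence "(\<Sum>x\<in>insert u S. p ^ \<omega> x) \<le> (\<Sum>x | x \<in> U \<and> \<omega> u \<le> \<omega> x. p ^ \<omega> x)"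
          using sub fin by (intro sum_mono2) auto
        hence room: "(\<Sum>x\<in>S. p ^ \<omega> x) + p ^ \<omega> u \<le> H * (p ^ f - p ^ \<omega> u)"
          using heavy[of u] sub notin insert.hyps(1) by simp
        have "\<exists>i<H. ?load i + p ^ \<omega> u \<le> p ^ f - 1"
        proof (rule ccontr)
          assume full: "\<not> ?thesis"
          have "p ^ f - p ^ \<omega> u \<le> ?load i" if "i < H" for i
          proof -
            have "\<not> ?load i + p ^ \<omega> u \<le> p ^ f - 1" using full that by blast
            thus ?thesis by linarith
          qed
          hence "(\<Sum>i<H. p ^ f - p ^ \<omega> u) \<le> (\<Sum>i<H. ?load i)" by (intro sum_mono) auto
          hence "H * (p ^ f - p ^ \<omega> u) \<le> (\<Sum>x\<in>S. p ^ \<omega> x)" using total by simp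
          moreover have "0 < p ^ \<omega> u" using p_ge_2 by simp
          ultimately show False using room by linarith
        qed
        then obtain i where i: "i < H" "?load i + p ^ \<omega> u \<le> p ^ f - 1" by blast
        let ?g = "g(u := i)"
        have "(\<Sum>x | x \<in> insert u S \<and> ?g x = k. p ^ \<omega> x) \<le> p ^ f - 1" if "k < H" for k
        proof (cases "k = i")
          case True
          have "{x. x \<in> insert u S \<and> ?g x = k} = insert u {x. x \<in> S \<and> g x = i}"
            using True notin by auto
          thus ?thesis using i(2) notin insert.hyps(1) by simp
        next
          case False
          have "{x. x \<in> insert u S \<and> ?g x = k} = {x. x \<in> S \<and> g x = k}"
            using False notin by auto
          thus ?thesis using g(2)[OF that] by simp
        qed
        moreover have "\<forall>x\<in>insert u S. ?g x < H" using g(1) i(1) by auto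
        ultimately show "\<exists>g. (\<forall>x\<in>insert u S. g x < H) \<and>
            (\<forall>i<H. (\<Sum>x | x \<in> insert u S \<and> g x = i. p ^ \<omega> x) \<le> p ^ f - 1)" by blast
      qed
    qed
  qed simp
  thus ?thesis using fin by blast
qed

end

text \<open>The rotation \<open>r\<close> is chosen to minimise the weight of \<open>n\<close>; \<open>H\<close> is then the height.\<close>

locale minimal_rotation = base_power +
  fixes n N r H :: nat
  assumes n_less: "n < p ^ N"
    and minimal: "wt r N (digit p n) \<le> wt r' N (digit p n)"
    and weight: "wt r N (digit p n) = H * (p ^ f - 1)"
begin

text \<open>The bins are filled completely, since their total capacity is the weight of \<open>n\<close>. So every bin has weight
  \<open>q - 1\<close> and is the digit function of a positive multiple of \<open>q - 1\<close>.\<close>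

lemma composition_exists: "\<exists>Xs. is_composition p (p ^ f) n H Xs"
proof -
  let ?d = "digit p n"
  \<comment> \<open>The pair \<open>(j, k)\<close> is the \<open>k\<close>-th of the copies of \<open>p ^ j\<close> in \<open>n\<close>.\<close>
  define U where "U = Sigma {..<N} (\<lambda>j. {..<?d j})"
  define \<omega> where "\<omega> = (\<lambda>(j :: nat, k :: nat). cls r j)"
  have finU: "finite U" by (simp add: U_def)
  have over_U: "(\<Sum>x | x \<in> U \<and> Q x. p ^ \<omega> x) = (\<Sum>j<N. card {k. k < ?d j \<and> Q (j, k)} * p ^ cls r j)" for Q
  proof -
    have "{x. x \<in> U \<and> Q x} = Sigma {..<N} (\<lambda>j. {k. k < ?d j \<and> Q (j, k)})"
      by (auto simp: U_def)
    hence "(\<Sum>x | x \<in> U \<and> Q x. p ^ \<omega> x)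
        = (\<Sum>(j, k)\<in>Sigma {..<N} (\<lambda>j. {k. k < ?d j \<and> Q (j, k)}). p ^ cls r j)"
      by (simp add: \<omega>_def case_prod_unfold)
    also have "\<dots> = (\<Sum>j<N. \<Sum>k | k < ?d j \<and> Q (j, k). p ^ cls r j)"
      by (intro sum.Sigma[symmetric]) auto
    finally show ?thesis by simp
  qed
  have heavy: "(\<Sum>x | x \<in> U \<and> v \<le> \<omega> x. p ^ \<omega> x) \<le> H * (p ^ f - p ^ v)" if "v < f" for v
  proof -
    have "(\<Sum>x | x \<in> U \<and> v \<le> \<omega> x. p ^ \<omega> x) = (\<Sum>j | j < N \<and> v \<le> cls r j. ?d j * p ^ cls r j)"
      unfolding over_U by (intro sum.mono_neutral_cong_right) (auto simp: \<omega>_def)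
    thus ?thesis using heavy_part_bound[OF minimal weight that] by simp
  qed
  have "\<exists>g. (\<forall>u\<in>U. g u < H) \<and> (\<forall>i<H. (\<Sum>x | x \<in> U \<and> g x = i. p ^ \<omega> x) \<le> p ^ f - 1)"
    by (rule greedy_bins[OF finU]) (auto simp: \<omega>_def cls_less intro!: heavy[unfolded \<omega>_def])
  then obtain g where g: "\<And>u. u \<in> U \<Longrightarrow> g u < H"
    "\<And>i. i < H \<Longrightarrow> (\<Sum>x | x \<in> U \<and> g x = i. p ^ \<omega> x) \<le> p ^ f - 1" by blast
  define e where "e i j = card {k. k < ?d j \<and> g (j, k) = i}" for i j
  have e_sum: "(\<Sum>i<H. e i j) = ?d j" if "j < N" for j
  proof -
    have "(\<Sum>i<H. e i j) = (\<Sum>i<H. \<Sum>k | k \<in> {..<?d j} \<and> g (j, k) = i. 1)"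
      by (simp add: e_def)
    also have "\<dots> = (\<Sum>k\<in>{..<?d j}. 1)"
      using g(1) that by (intro sum.group) (auto simp: U_def)
    finally show ?thesis by simp
  qed
  have e_le: "e i j \<le> ?d j" for i j
    unfolding e_def using card_mono[of "{..<?d j}" "{k. k < ?d j \<and> g (j, k) = i}"] by auto
  hence e_less: "e i j < p" for i j using digit_less[of n j] le_less_trans by blast
  define X where "X i = val N (e i)" for i
  have dX: "digit p (X i) j = (if j < N then e i j else 0)" for i j
    unfolding X_def using e_less by (rule digit_val)
  have XN: "X i < p ^ N" for i unfolding X_def using e_less by (rule val_less_power)
  have wtX: "wt r N (digit p (X i)) = (\<Sum>x | x \<in> U \<and> g x = i. p ^ \<omega> x)" for i
    unfolding over_U by (simp add: wt_def dX e_def)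
  have "(\<Sum>i<H. wt r N (digit p (X i))) = wt r N (\<lambda>j. \<Sum>i<H. e i j)"
    unfolding wt_def by (subst sum.swap) (simp add: dX sum_distrib_right)
  also have "\<dots> = (\<Sum>i<H. p ^ f - 1)" using weight by (simp add: wt_def e_sum)
  finally have tot: "(\<Sum>i<H. wt r N (digit p (X i))) = (\<Sum>i<H. p ^ f - 1)" .
  have full: "wt r N (digit p (X i)) = p ^ f - 1" if "i < H" for i
    using sum_mono_inv[OF tot, of i] g(2) that wtX by auto
  have "is_composition p (p ^ f) n H (map X [0..<H])"
    unfolding is_composition_def no_carry_def
  proof (intro conjI ballI allI)
    fix x assume "x \<in> set (map X [0..<H])"
    then obtain i where i: "i < H" "x = X i" by auto
    show "p ^ f - 1 dvd x" using dvd_wt_iff[OF XN, of r i] full[OF i(1)] i(2) by simp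
    show "0 < x"
    proof (rule ccontr)
      assume "\<not> 0 < x"
      hence "wt r N (digit p (X i)) = 0" using i(2) by (simp add: wt_def)
      thus False using full[OF i(1)] period_pos by simp
    qed
  next
    have "sum_list (map X [0..<H]) = (\<Sum>i<H. val N (e i))"
      by (simp add: X_def interv_sum_list_conv_sum_set_nat atLeast0LessThan)
    also have "\<dots> = val N (\<lambda>j. \<Sum>i<H. e i j)"
      unfolding val_def by (subst sum.swap) (simp add: sum_distrib_right)
    also have "\<dots> = val N ?d" by (simp add: val_def e_sum)
    finally show "sum_list (map X [0..<H]) = n" using val_digit[OF n_less] by simp
  next
    fix j
    have "(\<Sum>x\<leftarrow>map X [0..<H]. digit p x j) = (\<Sum>i<H. digit p (X i) j)"
      by (simp add: interv_sum_list_conv_sum_set_nat atLeast0LessThan comp_def)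
    also have "\<dots> = (if j < N then ?d j else 0)" by (simp add: dX e_sum)
    also have "\<dots> < p" using digit_less p_ge_2 by simp
    finally show "(\<Sum>x\<leftarrow>map X [0..<H]. digit p x j) < p" .
  qed simp
  thus ?thesis ..
qed

text \<open>Along a chain the weight stays in one residue class modulo \<open>q - 1\<close> and increases strictly, so each step
  adds at least \<open>q - 1\<close>.\<close>

lemma chain_length_le:
  assumes start: "ns 0 = 0" and inj: "inj_on ns {0..h}"
    and step: "\<And>i. i < h \<Longrightarrow> prec p (p ^ f) (ns i) (ns (Suc i))"
    and last: "digit_le p (ns h) n"
  shows "h \<le> H"
proof -
  have dle: "digit_le p (ns i) n" if "i \<le> h" for i
    using that
  proof (induction i rule: inc_induct)
    case (step i)
    have "digit_le p (ns i) (ns (Suc i))" using assms(3)[OF step(2)] by (simp add: prec_def)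
    thus ?case using step.IH le_trans unfolding digit_le_def by blast
  qed (rule last)
  have below: "ns i < p ^ N" if "i \<le> h" for i
    using digit_le_imp_le[OF dle[OF that]] n_less by simp
  have "i * (p ^ f - 1) \<le> wt r N (digit p (ns i))" if "i \<le> h" for i
    using that
  proof (induction i)
    case (Suc i)
    let ?u = "digit p (ns i)" and ?v = "digit p (ns (Suc i))"
    have pr: "digit_le p (ns i) (ns (Suc i))" "[ns i = ns (Suc i)] (mod (p ^ f - 1))"
      using step[of i] Suc.prems by (auto simp: prec_def)
    define g where "g = (\<lambda>j. ?v j - ?u j)"
    have dv: "?v = (\<lambda>j. ?u j + g j)" using pr(1) by (auto simp: g_def digit_le_def)
    have "ns i \<noteq> ns (Suc i)" using inj_onD[OF inj, of i "Suc i"] Suc.prems by auto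
    hence "val N ?u \<noteq> val N ?v" using val_digit below Suc.prems by simp
    moreover have "val N ?v = val N ?u + val N g"
      using arg_cong[OF dv, of "val N"] by (simp only: val_add)
    ultimately have "val N g \<noteq> 0" by simp
    hence pos: "wt r N g \<noteq> 0" using p_ge_2 by (auto simp: val_def wt_def)
    have sum: "wt r N ?v = wt r N ?u + wt r N g" 
      using arg_cong[OF dv, of "wt r N"] by (simp only: wt_add)
    have "[wt r N ?v = p ^ r * ns (Suc i)] (mod (p ^ f - 1))" using below Suc.prems by (intro wt_cong) simp
    also have "[p ^ r * ns (Suc i) = p ^ r * ns i] (mod (p ^ f - 1))"
      using pr(2) by (intro cong_mult) (auto simp: cong_sym)
    also have "[p ^ r * ns i = wt r N ?u] (mod (p ^ f - 1))"
      using below Suc.prems by (intro cong_sym[OF wt_cong]) simp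
    finally have "[wt r N ?u + wt r N g = wt r N ?u + 0] (mod (p ^ f - 1))" unfolding sum by simp
    hence "p ^ f - 1 dvd wt r N g" by (simp only: cong_add_lcancel_nat cong_0_iff)
    hence "p ^ f - 1 \<le> wt r N g" using pos by (simp add: dvd_imp_le)
    thus ?case using Suc sum by simp
  qed simp
  hence "h * (p ^ f - 1) \<le> wt r N (digit p (ns h))" by simp
  also have "\<dots> \<le> wt r N (digit p n)" using last by (intro wt_mono) (simp add: digit_le_def)
  finally show ?thesis using weight period_pos by simp
qed

lemma composition_chain:
  assumes "is_composition p (p ^ f) n h Xs"
  shows "\<exists>ns :: nat \<Rightarrow> nat. ns 0 = 0 \<and> inj_on ns {0..h}
    \<and> (\<forall>i<h. prec p (p ^ f) (ns i) (ns (Suc i))) \<and> digit_le p (ns h) n"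
proof -
  have Xs: "length Xs = h" "\<And>X. X \<in> set Xs \<Longrightarrow> 0 < X \<and> p ^ f - 1 dvd X" "sum_list Xs = n" "no_carry p Xs"
    using assms by (auto simp: is_composition_def)
  define ns where "ns i = sum_list (take i Xs)" for i
  have Suc: "ns (Suc i) = ns i + Xs ! i" if "i < h" for i
    using that Xs(1) by (simp add: ns_def take_Suc_conv_app_nth)
  have dig: "digit p (ns i) j = (\<Sum>X\<leftarrow>take i Xs. digit p X j)" for i j
    unfolding ns_def
  proof (rule digit_sum_list)
    have "(\<Sum>X\<leftarrow>take i Xs. digit p X j) \<le> (\<Sum>X\<leftarrow>take i Xs @ drop i Xs. digit p X j)" for j
      unfolding map_append sum_list_append by simp
    thus "no_carry p (take i Xs)" using Xs(4) unfolding no_carry_def append_take_drop_id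
      by (meson le_less_trans)
  qed
  have up: "ns i < ns (Suc i)" if "i < h" for i using Suc[OF that] Xs(1,2) that by simp
  have mono: "ns i < ns k" if "Suc i \<le> k" "k \<le> h" for i k
    using that
  proof (induction k rule: dec_induct)
    case base
    thus ?case using up by simp
  next
    case (step k)
    thus ?case using up[of k] by simp
  qed
  have "inj_on ns {0..h}"
  proof (rule linorder_inj_onI)
    fix i k assume "i < k" "i \<in> {0..h}" "k \<in> {0..h}"
    thus "ns i \<noteq> ns k" using mono[of i k] by simp
  qed auto
  moreover have "prec p (p ^ f) (ns i) (ns (Suc i))" if "i < h" for i
  proof -
    have "digit_le p (ns i) (ns (Suc i))"
      using that Xs(1) unfolding digit_le_def dig by (simp add: take_Suc_conv_app_nth)
    moreover have "[0 = Xs ! i] (mod (p ^ f - 1))"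
      using Xs(1,2) that by (simp add: cong_sym_eq[of 0] cong_0_iff)
    hence "[ns i + 0 = ns i + Xs ! i] (mod (p ^ f - 1))" by (intro cong_add) auto
    hence "[ns i = ns (Suc i)] (mod (p ^ f - 1))" using Suc[OF that] by simp
    ultimately show ?thesis by (simp add: prec_def)
  qed
  moreover have "ns 0 = 0" "ns h = n" using Xs(1,3) by (simp_all add: ns_def)
  ultimately show ?thesis by (intro exI[of _ ns]) (auto simp: digit_le_def)
qed

lemma height_eq: "ht p (p ^ f) n = H"
  unfolding ht_def
proof (rule Max_eqI)
  let ?S = "{h. \<exists>ns :: nat \<Rightarrow> nat. ns 0 = 0 \<and> inj_on ns {0..h}
      \<and> (\<forall>i<h. prec p (p ^ f) (ns i) (ns (Suc i))) \<and> digit_le p (ns h) n}"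
  show le: "h \<le> H" if "h \<in> ?S" for h using that chain_length_le by blast
  show "finite ?S" by (rule finite_subset[of _ "{..H}"]) (use le in auto)
  show "H \<in> ?S" using composition_exists composition_chain by blast
qed

text \<open>Each of the \<open>H\<close> parts weighs at least \<open>q - 1\<close> and together they weigh \<open>H * (q - 1)\<close>.\<close>

lemma composition_weight:
  assumes "is_composition p (p ^ f) n H Xs" "X \<in> set Xs"
  shows "X < p ^ N" "wt r N (digit p X) = p ^ f - 1"
proof -
  have Xs: "length Xs = H" "\<And>X. X \<in> set Xs \<Longrightarrow> 0 < X \<and> p ^ f - 1 dvd X" "sum_list Xs = n" "no_carry p Xs"
    using assms by (auto simp: is_composition_def)
  have less: "Y < p ^ N" if "Y \<in> set Xs" for Y
    using member_le_sum_list[OF that] Xs(3) n_less by simp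
  have ge: "p ^ f - 1 \<le> wt r N (digit p Y)" if "Y \<in> set Xs" for Y
    using wt_ge_period less Xs(2) that by simp
  have "digit p n = (\<lambda>j. \<Sum>X\<leftarrow>Xs. digit p X j)" using digit_sum_list[OF Xs(4)] Xs(3) by auto
  hence "(\<Sum>Y\<leftarrow>Xs. wt r N (digit p Y)) = H * (p ^ f - 1)" using weight wt_sum_list by simp
  hence tot: "(\<Sum>i<H. p ^ f - 1) = (\<Sum>i<H. wt r N (digit p (Xs ! i)))"
    using Xs(1) by (simp add: sum_list_sum_nth atLeast0LessThan)
  obtain i where i: "i < H" "X = Xs ! i" using assms(2) Xs(1) by (metis in_set_conv_nth)
  have "p ^ f - 1 = wt r N (digit p (Xs ! i))"
    using i ge Xs(1) by (intro sum_mono_inv[OF tot]) auto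
  thus "wt r N (digit p X) = p ^ f - 1" using i by simp
  show "X < p ^ N" using less assms(2) by simp
qed

end

section \<open>The Sheats composition\<close>

lemma finite_compositions: "finite {Xs. is_composition p q n h Xs}"
proof (rule finite_subset)
  show "{Xs. is_composition p q n h Xs} \<subseteq> {Xs. set Xs \<subseteq> {..n} \<and> length Xs = h}"
    by (auto simp: is_composition_def intro: member_le_sum_list)
  show "finite {Xs :: nat list. set Xs \<subseteq> {..n} \<and> length Xs = h}"
    by (rule finite_lists_length_eq) simp
qed

text \<open>The lexicographic order is linear and there are finitely many compositions, so the maximum exists, is
  unique, and is the value of the definite description.\<close>

lemma Sh_greatest:
  assumes "is_composition p q n (ht p q n) Zs"
  shows "is_composition p q n (ht p q n) (Sh p q n)"
    and "is_composition p q n (ht p q n) Ys \<Longrightarrow> rev Ys \<le> rev (Sh p q n)"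
proof -
  let ?C = "{Xs. is_composition p q n (ht p q n) Xs}"
  define M where "M = rev (Max (rev ` ?C))"
  have fin: "finite (rev ` ?C)" using finite_compositions by blast
  have "Max (rev ` ?C) \<in> rev ` ?C" using fin assms by (intro Max_in) auto
  hence M: "M \<in> ?C" by (auto simp: M_def)
  have max: "rev Ys \<le> rev M" if "Ys \<in> ?C" for Ys
    using fin that by (auto simp: M_def intro: Max_ge)
  have "Sh p q n = M"
    unfolding Sh_def
  proof (rule the_equality)
    show "is_composition p q n (ht p q n) M \<and> (\<forall>Ys. is_composition p q n (ht p q n) Ys \<longrightarrow>
        Ys = M \<or> (rev Ys, rev M) \<in> lexord {(x, y). x < y})"
      using M max by (auto simp: list_le_def list_less_def)
  next
    fix L assume L: "is_composition p q n (ht p q n) L \<and> (\<forall>Ys. is_composition p q n (ht p q n) Ys \<longrightarrow>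
        Ys = L \<or> (rev Ys, rev L) \<in> lexord {(x, y). x < y})"
    hence "rev M \<le> rev L" using M by (auto simp: list_le_def list_less_def)
    moreover have "rev L \<le> rev M" using L max by simp
    ultimately show "L = M" by simp
  qed
  thus "is_composition p q n (ht p q n) (Sh p q n)"
    and "is_composition p q n (ht p q n) Ys \<Longrightarrow> rev Ys \<le> rev (Sh p q n)"
    using M max by auto
qed

context minimal_rotation
begin

text \<open>The swapped numbers again have weight \<open>q - 1\<close>, hence are positive multiples of \<open>q - 1\<close>, and their digits
  have the same sums. They give another composition, which agrees with the old one in all the entries after \<open>A\<close>.\<close>

lemma neighbours_exchange_optimal:
  assumes comp: "is_composition p (p ^ f) n H (Ps @ B # A # Qs)"
    and max: "\<And>Ys. is_composition p (p ^ f) n H Ys \<Longrightarrow> rev Ys \<le> rev (Ps @ B # A # Qs)"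
  shows "exchange_optimal p f r N (digit p A) (digit p B)"
proof unfold_locales
  note AB = composition_weight[OF comp, of A] composition_weight[OF comp, of B]
  have C: "length (Ps @ B # A # Qs) = H" "\<And>X. X \<in> set (Ps @ B # A # Qs) \<Longrightarrow> 0 < X \<and> p ^ f - 1 dvd X"
    "sum_list (Ps @ B # A # Qs) = n" "no_carry p (Ps @ B # A # Qs)"
    using comp by (auto simp: is_composition_def)
  show nc: "digit p A j + digit p B j < p" for j
    using C(4) unfolding no_carry_def by (auto dest!: spec[of _ j])
  show "wt r N (digit p A) = p ^ f - 1" "wt r N (digit p B) = p ^ f - 1" using AB by auto
  show "digit p A j = 0" "digit p B j = 0" if "N \<le> j" for j
    using digit_eq_0 AB that by auto
  fix s t :: "nat \<Rightarrow> nat"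
  assume s: "\<And>j. s j \<le> digit p A j" and t: "\<And>j. t j \<le> digit p B j" and st: "wt r N s = wt r N t"
  define a' where "a' = (\<lambda>j. digit p A j - s j + t j)"
  define b' where "b' = (\<lambda>j. digit p B j - t j + s j)"
  have sum': "a' j + b' j = digit p A j + digit p B j" for j
    using s[of j] t[of j] by (simp add: a'_def b'_def)
  have less: "a' j < p" "b' j < p" for j using sum'[of j] nc[of j] by linarith+
  define A' where "A' = val N a'"
  define B' where "B' = val N b'"
  have dA: "digit p A' j = (if j < N then a' j else 0)" for j
    unfolding A'_def using less(1) by (rule digit_val)
  have dB: "digit p B' j = (if j < N then b' j else 0)" for j
    unfolding B'_def using less(2) by (rule digit_val)
  have ls: "A' < p ^ N" "B' < p ^ N" unfolding A'_def B'_def using less val_less_power by auto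
  have fa: "(\<lambda>j. a' j + s j) = (\<lambda>j. digit p A j + t j)" 
  proof
    fix j show "a' j + s j = digit p A j + t j" using s[of j] by (simp add: a'_def)
  qed
  have fb: "(\<lambda>j. b' j + t j) = (\<lambda>j. digit p B j + s j)" 
  proof
    fix j show "b' j + t j = digit p B j + s j" using t[of j] by (simp add: b'_def)
  qed
  have vA: "A' + val N s = A + val N t"
    using arg_cong[OF fa, of "val N"] AB by (simp add: val_add A'_def val_digit)
  have vB: "B' + val N t = B + val N s"
    using arg_cong[OF fb, of "val N"] AB by (simp add: val_add B'_def val_digit)
  have wA: "wt r N (digit p A') = p ^ f - 1"
  proof -
    have "wt r N (digit p A') = wt r N a'" by (simp add: wt_def dA)
    thus ?thesis using arg_cong[OF fa, of "wt r N"] AB st by (simp add: wt_add)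
  qed
  have wB: "wt r N (digit p B') = p ^ f - 1"
  proof -
    have "wt r N (digit p B') = wt r N b'" by (simp add: wt_def dB)
    thus ?thesis using arg_cong[OF fb, of "wt r N"] AB st by (simp add: wt_add)
  qed
  have good: "0 < X \<and> p ^ f - 1 dvd X" if "X < p ^ N" "wt r N (digit p X) = p ^ f - 1" for X
  proof
    show "p ^ f - 1 dvd X" using dvd_wt_iff[OF that(1), of r] that(2) by simp
    show "0 < X" using that(2) period_pos by (cases "X = 0") (auto simp: wt_def)
  qed
  have "is_composition p (p ^ f) n H (Ps @ B' # A' # Qs)"
    unfolding is_composition_def
  proof (intro conjI ballI)
    show "length (Ps @ B' # A' # Qs) = H" using C(1) by simp
    show "0 < X" "p ^ f - 1 dvd X" if "X \<in> set (Ps @ B' # A' # Qs)" for X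
      using that C(2)[of X] good[OF ls(1) wA] good[OF ls(2) wB] by auto
    show "sum_list (Ps @ B' # A' # Qs) = n" using C(3) vA vB by simp
    have "digit p A' j + digit p B' j \<le> digit p A j + digit p B j" for j
      using sum'[of j] by (simp add: dA dB)
    hence "(\<Sum>X\<leftarrow>Ps @ B' # A' # Qs. digit p X j) \<le> (\<Sum>X\<leftarrow>Ps @ B # A # Qs. digit p X j)" for j
      by (simp add: add_ac)
    thus "no_carry p (Ps @ B' # A' # Qs)" using C(4) unfolding no_carry_def by (meson le_less_trans)
  qed
  hence le: "rev (Ps @ B' # A' # Qs) \<le> rev (Ps @ B # A # Qs)" by (rule max)
  show "val N t \<le> val N s"
  proof (rule ccontr)
    assume "\<not> ?thesis"
    hence "A < A'" using vA by simp
    hence "rev (Ps @ B # A # Qs) < rev (Ps @ B' # A' # Qs)"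
      by (simp add: list_less_def lexord_append_leftI)
    thus False using le by simp
  qed
qed

lemma neighbours_ratio:
  assumes "is_composition p (p ^ f) n H (Ps @ B # A # Qs)"
    and "\<And>Ys. is_composition p (p ^ f) n H Ys \<Longrightarrow> rev Ys \<le> rev (Ps @ B # A # Qs)"
  shows "p ^ f * B \<le> A"
proof (rule ccontr)
  interpret exchange_optimal p f r N "digit p A" "digit p B"
    using assms by (rule neighbours_exchange_optimal)
  assume "\<not> ?thesis"
  hence "A < p ^ f * B" by simp
  then obtain i where i: "digit p A i < digit p (p ^ f * B) i"
    "\<And>j. i < j \<Longrightarrow> digit p A j = digit p (p ^ f * B) j"
    by (rule less_imp_top_digit_less) blast
  have "f \<le> i" using i(1) by (simp add: digit_power_mult split: if_splits)
  hence "first_difference p f r N (digit p A) (digit p B) (i - f)"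
    using i by unfold_locales (simp_all add: digit_power_mult)
  thus False by (rule first_difference.impossible)
qed

end

theorem theorem4p11:
  fixes p f q n h :: nat and Xs :: "nat list"
  assumes "prime p" and "f \<ge> 1" and "q = p ^ f"
    and "n \<ge> 1" and "(q - 1) dvd n"
    and "h = ht p q n" and "h \<ge> 2"
    and "Xs = Sh p q n"
  shows "\<forall>i. 1 \<le> i \<and> i < h \<longrightarrow> Xs ! ((i + 1) - 1) \<ge> q * Xs ! (i - 1)"
proof (intro allI impI)
  fix i assume i: "1 \<le> i \<and> i < h"
  interpret base_power p f
    using assms(1,2) by unfold_locales (auto simp: prime_ge_2_nat)
  have n_less: "n < p ^ n" using p_ge_2 by (simp add: power_gt_expt)
  obtain r where r: "\<And>r'. wt r n (digit p n) \<le> wt r' n (digit p n)"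
    using ex_has_least_nat[of "\<lambda>_. True" _ "\<lambda>r. wt r n (digit p n)"] by blast
  have "p ^ f - 1 dvd wt r n (digit p n)" using dvd_wt_iff[OF n_less] assms(3,5) by simp
  then obtain H where H: "wt r n (digit p n) = H * (p ^ f - 1)" by (metis dvd_def mult.commute)
  interpret minimal_rotation p f n n r H
    using n_less r H by unfold_locales
  have ht: "ht p q n = H" using height_eq assms(3) by simp
  obtain Zs where "is_composition p q n (ht p q n) Zs" using composition_exists ht assms(3) by auto
  note Sh = Sh_greatest[OF this, folded assms(8), unfolded ht, unfolded assms(3)]
  have "i - 1 < length Xs" "i < length Xs" using i Sh(1) ht assms(6) by (auto simp: is_composition_def)
  hence split: "Xs = take (i - 1) Xs @ Xs ! (i - 1) # Xs ! i # drop (i + 1) Xs"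
    using i id_take_nth_drop[of "i - 1" Xs] Cons_nth_drop_Suc[of i Xs] by simp
  have "p ^ f * Xs ! (i - 1) \<le> Xs ! i"
    using Sh by (rule neighbours_ratio[of "take (i - 1) Xs" "Xs ! (i - 1)" "Xs ! i" "drop (i + 1) Xs", folded split])
  thus "Xs ! ((i + 1) - 1) \<ge> q * Xs ! (i - 1)" using assms(3) by simp
qed

end
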